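(* There exists an absolute constant $\delta>0$ such that for every $p\in(0,1)$ and every function $h\colon\mathbb N\to[0,\infty)$ with $h(n)=o(\sqrt{p(1-p)n})$ as $n\to\infty$, the following holds for all large enough $n$: if $f\colon\{0,1\}^n\to\{0,1\}$ is a symmetric Boolean function with $\frac13\le\mathbb E_{\mu_p}[f]\le\frac23$, then $$\Pr_{\mu_p}[f\ne g]>\delta$$ for every Boolean function $g\colon\{0,1\}^n\to\{0,1\}$ satisfying $\mathrm{Inf}[g]\le h(n)$.
   Context: For $p\in(0,1)$, $\mu_p$ is the product measure on $\{0,1\}^n$ with $\mu_p(x)=p^{\sum_i x_i}(1-p)^{\sum_i(1-x_i)}$. A function on $\{0,1\}^n$ is symmetric if it is invariant under all permutations of the coordinates. The total influence of a Boolean function $g\colon\{0,1\}^n\to\{0,1\}$ (with respect to $p$) is $\mathrm{Inf}[g]=p(1-p)n\,\Pr[g(x)\ne g(y)]$, where $x\sim\mu_p$ and $y$ is obtained from $x$ by flipping one coordinate chosen uniformly at random among the $n$ coordinates. *)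

theory Defs
  imports "HOL-Probability.Probability" "HOL-Library.Landau_Symbols"
begin

text \<open>
  A point of the cube is a function from the naturals to the booleans that is False at
  every index \<open>\<ge> n\<close>; the coordinates are indexed by \<open>{..<n}\<close>, and True stands for 1.
  A Boolean function is a predicate on all such functions, of which only the values on the
  cube matter: every notion below ignores points outside of \<open>cube n\<close>.
\<close>

definition cube :: "nat \<Rightarrow> (nat \<Rightarrow> bool) set" where
  "cube n = PiE_dflt {..<n} False (\<lambda>_. UNIV)"

definition mu :: "real \<Rightarrow> nat \<Rightarrow> (nat \<Rightarrow> bool) pmf" where
  "mu p n = Pi_pmf {..<n} False (\<lambda>_. bernoulli_pmf p)"

lemma pmf_mu:
  assumes "0 < p" "p < 1" "x \<in> cube n"
  shows "pmf (mu p n) x =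
    p ^ (\<Sum>i<n. of_bool (x i)) * (1 - p) ^ (\<Sum>i<n. 1 - of_bool (x i))"
proof -
  have "pmf (mu p n) x = (\<Prod>i<n. pmf (bernoulli_pmf p) (x i))"
    using assms(3) unfolding mu_def cube_def by (intro pmf_Pi') (auto simp: PiE_dflt_def)
  also have "\<dots> = (\<Prod>i<n. p ^ of_bool (x i) * (1 - p) ^ (1 - of_bool (x i)))"
    using assms(1,2) by (intro prod.cong) auto
  also have "\<dots> = p ^ (\<Sum>i<n. of_bool (x i)) * (1 - p) ^ (\<Sum>i<n. 1 - of_bool (x i))"
    by (simp only: prod.distrib power_sum)
  finally show ?thesis .
qed

lemma set_pmf_mu: "0 < p \<Longrightarrow> p < 1 \<Longrightarrow> set_pmf (mu p n) = cube n"
  by (simp add: mu_def cube_def set_Pi_pmf)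

definition symmetric_fun :: "nat \<Rightarrow> ((nat \<Rightarrow> bool) \<Rightarrow> bool) \<Rightarrow> bool" where
  "symmetric_fun n f \<longleftrightarrow> (\<forall>\<pi>. \<pi> permutes {..<n} \<longrightarrow> (\<forall>x\<in>cube n. f (x \<circ> \<pi>) = f x))"

text \<open>For \<open>n = 0\<close> there is no coordinate to flip; the factor \<open>n\<close> then makes the influence 0.\<close>

definition total_influence :: "real \<Rightarrow> nat \<Rightarrow> ((nat \<Rightarrow> bool) \<Rightarrow> bool) \<Rightarrow> real" where
  "total_influence p n g = p * (1 - p) * real n *
     measure_pmf.prob (pair_pmf (mu p n) (pmf_of_set {..<n}))
       {(x, i). g x \<noteq> g (x(i := \<not> x i))}"

end

theory Submission
  imports Defs
begin

text \<open>
  Write \<open>G k\<close> for the fraction of layer \<open>k\<close> (the points with exactly \<open>k\<close> ones) on which \<open>g\<close> holds.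
  The idea is that a function \<open>g\<close> of influence \<open>o(\<surd>n)\<close> cannot tell the central layers apart, so that
  \<open>G\<close> is nearly constant there, whereas a symmetric function has density 0 or 1 on each layer and,
  if balanced, takes both values on a constant fraction of the central mass.

  Since \<open>p\<close> is fixed while \<open>n\<close> grows, every constant other than \<open>\<delta>\<close> may depend on \<open>p\<close>. The central
  layers are those with \<open>\<bar>k - np\<bar> < 2\<surd>n\<close>, and by Hoeffding's inequality they carry all but \<open>2/9\<close> of
  the mass.

  Counting the edges between layers \<open>k\<close> and \<open>k + 1\<close> from both ends shows that
  \<open>\<bar>G (k + 1) - G k\<bar>\<close> is at most the fraction of these edges on which \<open>g\<close> changes
  (\<open>layer_density_step\<close>). The influence is at least a constant times the sum of these fractions,
  each weighted by the mass of its edges, which is of order \<open>n\<close> times the binomial weight of \<open>k\<close>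
  (\<open>total_influence_ge\<close>). On the central layers all binomial weights are at least a constant times
  \<open>1/\<surd>n\<close>: neighbouring weights have ratio \<open>1 + O(1/\<surd>n)\<close>, so over \<open>O(\<surd>n)\<close> steps they stay within a
  constant factor of each other, and together they add up to at least \<open>7/9\<close>
  (\<open>binomial_window_lower_bound\<close>). Hence these edge masses are at least of order \<open>\<surd>n\<close>, and the
  total variation of \<open>G\<close> over the central layers is \<open>O(Inf[g]/\<surd>n) = o(1)\<close> (\<open>layer_density_oscillation_le\<close>).

  Let now \<open>\<gamma>\<close> be the approximate value of \<open>G\<close>. On a central layer with \<open>f = 1\<close> the functions
  disagree on a fraction about \<open>1 - \<gamma>\<close>, on one with \<open>f = 0\<close> on a fraction about \<open>\<gamma>\<close>. Both kinds of
  central layers have total mass at least \<open>1/3 - 2/9 = 1/9\<close>, so the disagreement is at least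
  \<open>(1 - \<gamma>)/9 + \<gamma>/9 - o(1) = 1/9 - o(1)\<close> (\<open>disagreement_ge\<close>).
\<close>

section \<open>Layers of the cube\<close>

definition weight :: "nat \<Rightarrow> (nat \<Rightarrow> bool) \<Rightarrow> nat" where
  "weight n x = card {i. i < n \<and> x i}"

definition layer :: "nat \<Rightarrow> nat \<Rightarrow> (nat \<Rightarrow> bool) set" where
  "layer n k = {x\<in>cube n. weight n x = k}"

lemma finite_cube [simp]: "finite (cube n)"
  unfolding cube_def by (intro finite_PiE_dflt) auto

lemma finite_layer [simp]: "finite (layer n k)"
  by (simp add: layer_def)

lemma weight_le: "weight n x \<le> n"
  unfolding weight_def by (rule order.trans[OF card_mono[of "{..<n}"]]) auto

lemma card_zeros: "card {i. i < n \<and> \<not> x i} = n - weight n x"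
proof -
  have "{i. i < n \<and> \<not> x i} = {..<n} - {i. i < n \<and> x i}" by auto
  moreover have "card \<dots> = n - card {i. i < n \<and> x i}"
    by (subst card_Diff_subset) auto
  ultimately show ?thesis by (simp add: weight_def)
qed

lemma weight_set_True:
  assumes "i < n" "\<not> x i"
  shows "weight n (x(i := True)) = Suc (weight n x)"
proof -
  have "{j. j < n \<and> (x(i := True)) j} = insert i {j. j < n \<and> x j}"
    using assms by auto
  then show ?thesis using assms by (simp add: weight_def)
qed

lemma set_True_in_layer:
  assumes "x \<in> layer n k" "i < n" "\<not> x i"
  shows "x(i := True) \<in> layer n (Suc k)"
  using assms weight_set_True[of i n x] by (auto simp: layer_def cube_def PiE_dflt_def)

lemma weight_set_False:
  assumes "i < n" "y i"
  shows "Suc (weight n (y(i := False))) = weight n y"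
proof -
  have "{j. j < n \<and> y j} = insert i {j. j < n \<and> (y(i := False)) j}"
    using assms by auto
  moreover have "i \<notin> {j. j < n \<and> (y(i := False)) j}" by auto
  ultimately show ?thesis by (simp add: weight_def)
qed

lemma set_False_in_layer:
  assumes "y \<in> layer n (Suc k)" "i < n" "y i"
  shows "y(i := False) \<in> layer n k"
  using assms weight_set_False[of i n y] by (auto simp: layer_def cube_def PiE_dflt_def)

text \<open>
  Two points of a layer, read as words over \<open>{0, 1}\<close>, have the same multiset of letters, so one
  is a rearrangement of the other.
\<close>

lemma symmetric_fun_eq:
  assumes "symmetric_fun n f" "x \<in> layer n k" "y \<in> layer n k"
  shows "f x = f y"
proof -
  have cnt: "count (image_mset z (mset_set {..<n})) b = (if b then k else n - k)"
    if "z \<in> layer n k" for z b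
  proof -
    have "z -` {b} \<inter> {..<n} = {i. i < n \<and> z i = b}" by auto
    then show ?thesis
      using that card_zeros[of n z] by (auto simp: count_image_mset layer_def weight_def)
  qed
  have "image_mset x (mset_set {..<n}) = image_mset y (mset_set {..<n})"
    using assms(2,3) by (intro multiset_eqI) (simp add: cnt)
  then obtain \<pi> where \<pi>: "\<pi> permutes {..<n}" "\<forall>i\<in>{..<n}. x i = y (\<pi> i)"
    using image_mset_eq_implies_permutes[of "{..<n}" x y] by auto
  have "x = y \<circ> \<pi>"
  proof
    fix i
    show "x i = (y \<circ> \<pi>) i"
      using \<pi> assms(2,3) by (cases "i < n")
        (auto simp: layer_def cube_def PiE_dflt_def permutes_def)
  qed
  then show ?thesis
    using assms \<pi>(1) by (auto simp: symmetric_fun_def layer_def)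
qed

lemma sum_cube_by_layers:
  "(\<Sum>x\<in>cube n. \<phi> x) = (\<Sum>k\<le>n. \<Sum>x\<in>layer n k. (\<phi> x :: real))"
  unfolding layer_def by (rule sum.group[symmetric]) (auto simp: weight_le)

text \<open>
  The two sums run over the same edges between consecutive layers. On the left \<open>\<phi> y\<close> is merely
  repeated once for each edge going down from \<open>y\<close>; the inner sum is kept so that both sides range
  over edges.
\<close>

lemma sum_edges_from_above:
  fixes \<phi> :: "(nat \<Rightarrow> bool) \<Rightarrow> real"
  shows "(\<Sum>y\<in>layer n (Suc k). \<Sum>i | i < n \<and> y i. \<phi> y) =
         (\<Sum>x\<in>layer n k. \<Sum>i | i < n \<and> \<not> x i. \<phi> (x(i := True)))"
proof -
  have "(\<Sum>(y, i)\<in>(SIGMA y:layer n (Suc k). {i. i < n \<and> y i}). \<phi> y) =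
        (\<Sum>(x, i)\<in>(SIGMA x:layer n k. {i. i < n \<and> \<not> x i}). \<phi> (x(i := True)))"
    by (rule sum.reindex_bij_witness[of _ "\<lambda>(x, i). (x(i := True), i)" "\<lambda>(y, i). (y(i := False), i)"])
       (auto simp: set_True_in_layer set_False_in_layer fun_upd_idem)
  then show ?thesis by (simp add: sum.Sigma del: sum_constant)
qed

section \<open>Central layers\<close>

definition window :: "real \<Rightarrow> nat \<Rightarrow> nat set" where
  "window p n = {k. \<bar>real k - real n * p\<bar> < 2 * sqrt (real n)}"

lemma window_convex: "a \<in> window p n \<Longrightarrow> b \<in> window p n \<Longrightarrow> a \<le> k \<Longrightarrow> k \<le> b \<Longrightarrow> k \<in> window p n"
  using of_nat_mono[of a k, where 'a = real] of_nat_mono[of k b, where 'a = real]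
  unfolding window_def mem_Collect_eq abs_less_iff by linarith

lemma window_diff:
  assumes "a \<in> window p n" "b \<in> window p n" "a \<le> b"
  shows "real (b - a) \<le> 4 * sqrt (real n)"
  using assms by (auto simp: window_def of_nat_diff)

lemma finite_window [simp]: "finite (window p n)"
proof (rule finite_subset)
  show "window p n \<subseteq> {..nat \<lceil>real n * p + 2 * sqrt (real n)\<rceil>}"
    unfolding window_def by (auto simp: abs_less_iff) linarith
qed simp

lemma card_window_le: "real (card (window p n)) \<le> 4 * sqrt (real n) + 1"
proof (cases "window p n = {}")
  case False
  define a b where "a = Min (window p n)" and "b = Max (window p n)"
  have ab: "a \<in> window p n" "b \<in> window p n" "a \<le> b"
    using False by (auto simp: a_def b_def)
  have "card (window p n) \<le> card {a..b}"
    by (intro card_mono) (auto simp: a_def b_def)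
  also have "\<dots> = (b - a) + 1"
    using ab(3) by simp
  finally have "real (card (window p n)) \<le> real (b - a) + 1"
    by linarith
  then show ?thesis using window_diff[OF ab] by linarith
qed simp

lemma window_nonempty:
  assumes "0 < p" "n > 0"
  shows "window p n \<noteq> {}"
proof -
  have "real (nat \<lfloor>real n * p\<rfloor>) = of_int \<lfloor>real n * p\<rfloor>"
    using assms by (intro of_nat_nat) simp
  moreover have "1 \<le> sqrt (real n)"
    using assms(2) by simp
  ultimately have "nat \<lfloor>real n * p\<rfloor> \<in> window p n"
    unfolding window_def mem_Collect_eq by linarith
  then show ?thesis by blast
qed

text \<open>
  Stated in both directions at once because no monotonicity of \<open>u\<close> is available: the binomial
  weights rise up to the mode, near \<open>np\<close>, and fall after it.
\<close>

lemma bounded_ratio_chain: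
  fixes u :: "nat \<Rightarrow> real"
  assumes "a \<le> b" "0 \<le> q" "\<And>j. a \<le> j \<Longrightarrow> j < b \<Longrightarrow> u (Suc j) \<le> q * u j \<and> u j \<le> q * u (Suc j)"
  shows "u b \<le> q ^ (b - a) * u a \<and> u a \<le> q ^ (b - a) * u b"
  using assms(1,3)
proof (induction b rule: dec_induct)
  case (step m)
  then have IH: "u m \<le> q ^ (m - a) * u a" "u a \<le> q ^ (m - a) * u m" by auto
  have m: "u (Suc m) \<le> q * u m" "u m \<le> q * u (Suc m)" using step by auto
  have "q * u m \<le> q * (q ^ (m - a) * u a)" "q ^ (m - a) * u m \<le> q ^ (m - a) * (q * u (Suc m))"
    using IH m assms(2) by (auto intro!: mult_left_mono)
  with IH m step(1) show ?case
    by (simp add: Suc_diff_le mult_ac)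
qed simp

section \<open>Layer masses and the boundary of a set\<close>

definition layer_mass ::
    "real \<Rightarrow> nat \<Rightarrow> ((nat \<Rightarrow> bool) \<Rightarrow> bool) \<Rightarrow> nat \<Rightarrow> real" where
  "layer_mass p n g k = (\<Sum>x\<in>layer n k. pmf (mu p n) x * of_bool (g x))"

text \<open>
  Only edges going up are listed, so that each edge between two layers occurs once, charged to
  its lower endpoint.
\<close>

definition up_boundary ::
    "real \<Rightarrow> nat \<Rightarrow> ((nat \<Rightarrow> bool) \<Rightarrow> bool) \<Rightarrow> nat \<Rightarrow> real" where
  "up_boundary p n g k =
     (\<Sum>x\<in>layer n k. \<Sum>i | i < n \<and> \<not> x i. pmf (mu p n) x * of_bool (g x \<noteq> g (x(i := True))))"

text \<open>
  The denominator is the mass of the whole layer (see \<open>layer_mass_True\<close>).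
\<close>

definition layer_density ::
    "real \<Rightarrow> nat \<Rightarrow> ((nat \<Rightarrow> bool) \<Rightarrow> bool) \<Rightarrow> nat \<Rightarrow> real" where
  "layer_density p n g k = layer_mass p n g k / pmf (binomial_pmf n p) k"

context
  fixes p :: real
  assumes p: "0 < p" "p < 1"
begin

lemma pmf_mu_layer:
  assumes "x \<in> layer n k"
  shows "pmf (mu p n) x = p ^ k * (1 - p) ^ (n - k)"
proof -
  have 1: "(\<Sum>i<n. of_bool (x i)) = k"
    using assms by (simp add: layer_def weight_def Int_def)
  have "(\<Sum>i<n. 1 - of_bool (x i)) = (\<Sum>i<n. of_bool (\<not> x i) :: nat)"
    by (intro sum.cong) auto
  also have "\<dots> = n - k"
    using assms card_zeros[of n x] by (simp add: layer_def Int_def)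
  finally show ?thesis
    using pmf_mu[OF p, of x n] assms 1 by (simp add: layer_def)
qed

text \<open>
  The detailed-balance relation between the endpoints of an edge: it is what allows an edge to be
  charged to either endpoint.
\<close>

lemma pmf_mu_set_True:
  assumes "x \<in> layer n k" "i < n" "\<not> x i"
  shows "(1 - p) * pmf (mu p n) (x(i := True)) = p * pmf (mu p n) x"
proof -
  have "Suc k \<le> n"
    using set_True_in_layer[OF assms] weight_le[of n "x(i := True)"] by (auto simp: layer_def)
  then have "n - k = Suc (n - Suc k)" by simp
  then show ?thesis
    using pmf_mu_layer[OF assms(1)] pmf_mu_layer[OF set_True_in_layer[OF assms]] by simp
qed

lemma prob_mu: "measure_pmf.prob (mu p n) S = (\<Sum>x\<in>cube n. pmf (mu p n) x * of_bool (x \<in> S))"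
proof -
  have "measure_pmf.prob (mu p n) S = measure_pmf.expectation (mu p n) (indicator S)"
    by simp
  also have "\<dots> = (\<Sum>x\<in>cube n. indicator S x * pmf (mu p n) x)"
    by (rule integral_measure_pmf_real) (simp_all add: set_pmf_mu p)
  finally show ?thesis
    by (simp add: indicator_def of_bool_def mult.commute)
qed

lemma layer_mass_True: "layer_mass p n (\<lambda>_. True) k = pmf (binomial_pmf n p) k"
proof -
  have "binomial_pmf n p = map_pmf (weight n) (mu p n)"
    using binomial_pmf_altdef'[of "{..<n}" n p False] p by (simp add: mu_def weight_def[abs_def])
  then have "pmf (binomial_pmf n p) k = measure_pmf.prob (mu p n) (weight n -` {k})"
    by (simp add: pmf_map)
  also have "\<dots> = (\<Sum>x\<in>cube n. if weight n x = k then pmf (mu p n) x else 0)"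
    unfolding prob_mu by (intro sum.cong) auto
  also have "\<dots> = layer_mass p n (\<lambda>_. True) k"
    unfolding layer_mass_def layer_def by (simp add: sum.inter_filter)
  finally show ?thesis ..
qed

lemma layer_mass_nonneg: "0 \<le> layer_mass p n g k"
  unfolding layer_mass_def by (intro sum_nonneg) auto

lemma layer_mass_le: "layer_mass p n g k \<le> pmf (binomial_pmf n p) k"
  unfolding layer_mass_True[symmetric] layer_mass_def by (intro sum_mono) auto

lemma up_boundary_nonneg: "0 \<le> up_boundary p n g k"
  unfolding up_boundary_def by (intro sum_nonneg) auto

text \<open>
  Every point of layer \<open>k + 1\<close> has \<open>k + 1\<close> edges going down and every point of layer \<open>k\<close> has
  \<open>n - k\<close> edges going up. After transport along the edges, the first term counts the edges whose
  upper end satisfies \<open>g\<close> and the second those whose lower end does, both with weight \<open>p\<close> times the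
  measure of the lower end; the two counts differ only on edges where \<open>g\<close> changes.
\<close>

lemma layer_mass_step:
  "\<bar>(1 - p) * real (Suc k) * layer_mass p n g (Suc k) - p * real (n - k) * layer_mass p n g k\<bar>
     \<le> p * up_boundary p n g k"
proof -
  let ?q = "pmf (mu p n)" and ?Z = "\<lambda>x. {i. i < n \<and> \<not> x i}"
  have "(1 - p) * real (Suc k) * layer_mass p n g (Suc k) =
        (1 - p) * (\<Sum>y\<in>layer n (Suc k). \<Sum>i | i < n \<and> y i. ?q y * of_bool (g y))"
    by (simp add: layer_mass_def layer_def weight_def sum_distrib_left mult_ac)
  also have "\<dots> = (1 - p) * (\<Sum>x\<in>layer n k. \<Sum>i\<in>?Z x. ?q (x(i := True)) * of_bool (g (x(i := True))))"
    by (simp only: sum_edges_from_above)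
  also have "\<dots> = (\<Sum>x\<in>layer n k. \<Sum>i\<in>?Z x. p * ?q x * of_bool (g (x(i := True))))"
    unfolding sum_distrib_left mult.assoc[symmetric]
    by (intro sum.cong refl arg_cong2[of _ _ _ _ "(*)"] pmf_mu_set_True) auto
  finally have up: "(1 - p) * real (Suc k) * layer_mass p n g (Suc k) =
    (\<Sum>x\<in>layer n k. \<Sum>i\<in>?Z x. p * ?q x * of_bool (g (x(i := True))))" .
  have "card (?Z x) = n - k" if "x \<in> layer n k" for x
    using that card_zeros[of n x] by (simp add: layer_def)
  then have down: "p * real (n - k) * layer_mass p n g k =
    (\<Sum>x\<in>layer n k. \<Sum>i\<in>?Z x. p * ?q x * of_bool (g x))"
    by (simp add: layer_mass_def sum_distrib_left mult_ac del: sum_mult_of_bool_eq sum_of_bool_mult_eq)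
  have "\<bar>(1 - p) * real (Suc k) * layer_mass p n g (Suc k) - p * real (n - k) * layer_mass p n g k\<bar> =
    \<bar>\<Sum>x\<in>layer n k. \<Sum>i\<in>?Z x. p * ?q x * (of_bool (g (x(i := True))) - of_bool (g x))\<bar>"
    unfolding up down by (simp add: sum_subtractf right_diff_distrib)
  also have "\<dots> \<le> (\<Sum>x\<in>layer n k. \<Sum>i\<in>?Z x. \<bar>p * ?q x * (of_bool (g (x(i := True))) - of_bool (g x))\<bar>)"
    by (intro order.trans[OF sum_abs] sum_mono sum_abs)
  also have "\<dots> = (\<Sum>x\<in>layer n k. \<Sum>i\<in>?Z x. p * (?q x * of_bool (g x \<noteq> g (x(i := True)))))"
    using p by (intro sum.cong refl) (auto simp: abs_mult)
  also have "\<dots> = p * up_boundary p n g k"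
    unfolding up_boundary_def sum_distrib_left ..
  finally show ?thesis .
qed

text \<open>
  For the constantly true function the boundary is empty and the masses are the binomial weights.
\<close>

lemma binomial_step:
  "(1 - p) * real (Suc k) * pmf (binomial_pmf n p) (Suc k) = p * real (n - k) * pmf (binomial_pmf n p) k"
proof -
  have "up_boundary p n (\<lambda>_. True) k = 0"
    by (simp add: up_boundary_def)
  then show ?thesis
    using layer_mass_step[of k n "\<lambda>_. True"] by (simp add: layer_mass_True)
qed

text \<open>
  Only flips from 0 to 1 are kept. By detailed balance the flips from 1 to 0 contribute
  \<open>p / (1 - p)\<close> times as much, which affects no more than a factor depending on \<open>p\<close>.
\<close>

lemma total_influence_ge:
  "p * (1 - p) * (\<Sum>k\<le>n. up_boundary p n g k) \<le> total_influence p n g"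
proof (cases "n = 0")
  case True
  then show ?thesis
    by (simp add: total_influence_def up_boundary_def)
next
  case False
  let ?q = "pmf (mu p n)" and ?S = "{(x, i). g x \<noteq> g (x(i := \<not> x i))}"
  have "measure_pmf.prob (pair_pmf (mu p n) (pmf_of_set {..<n})) ?S =
    measure_pmf.expectation (pair_pmf (mu p n) (pmf_of_set {..<n})) (indicator ?S)"
    by simp
  also have "\<dots> = (\<Sum>xi\<in>cube n \<times> {..<n}. indicator ?S xi * pmf (pair_pmf (mu p n) (pmf_of_set {..<n})) xi)"
    using False by (intro integral_measure_pmf_real) (auto simp: set_pmf_mu p lessThan_empty_iff)
  also have "\<dots> = (\<Sum>(x, i)\<in>cube n \<times> {..<n}. ?q x * of_bool (g x \<noteq> g (x(i := \<not> x i))) / n)"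
    using False by (intro sum.cong) (auto simp: pmf_pair indicator_def pmf_of_set lessThan_empty_iff)
  also have "\<dots> = (\<Sum>x\<in>cube n. \<Sum>i<n. ?q x * of_bool (g x \<noteq> g (x(i := \<not> x i)))) / n"
    by (simp add: sum_divide_distrib sum.cartesian_product case_prod_beta
        del: sum_mult_of_bool_eq sum_of_bool_mult_eq)
  finally have "total_influence p n g =
      p * (1 - p) * (\<Sum>x\<in>cube n. \<Sum>i<n. ?q x * of_bool (g x \<noteq> g (x(i := \<not> x i))))"
    using False by (simp add: total_influence_def)
  moreover have "(\<Sum>k\<le>n. up_boundary p n g k) =
      (\<Sum>x\<in>cube n. \<Sum>i | i < n \<and> \<not> x i. ?q x * of_bool (g x \<noteq> g (x(i := True))))"
    unfolding up_boundary_def sum_cube_by_layers ..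
  moreover have "\<dots> \<le> (\<Sum>x\<in>cube n. \<Sum>i<n. ?q x * of_bool (g x \<noteq> g (x(i := \<not> x i))))"
  proof (intro sum_mono)
    fix x
    have "(\<Sum>i | i < n \<and> \<not> x i. ?q x * of_bool (g x \<noteq> g (x(i := True)))) =
          (\<Sum>i | i < n \<and> \<not> x i. ?q x * of_bool (g x \<noteq> g (x(i := \<not> x i))))"
      by (intro sum.cong) auto
    also have "\<dots> \<le> (\<Sum>i<n. ?q x * of_bool (g x \<noteq> g (x(i := \<not> x i))))"
      by (intro sum_mono2) auto
    finally show "(\<Sum>i | i < n \<and> \<not> x i. ?q x * of_bool (g x \<noteq> g (x(i := True)))) \<le> \<dots>" .
  qed
  ultimately show ?thesis
    using p by (simp add: mult_left_mono)
qed

lemma layer_density_bounds: "0 \<le> layer_density p n g k" "layer_density p n g k \<le> 1"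
  using layer_mass_nonneg[of n g k] layer_mass_le[of n g k]
  by (auto simp: layer_density_def divide_le_eq_1 intro!: divide_nonneg_nonneg)

text \<open>
  By \<open>binomial_step\<close> the coefficients in \<open>layer_mass_step\<close>, multiplied by the masses of the two
  layers, give the same number \<open>w\<close>; dividing by it turns masses into densities.
\<close>

lemma layer_density_step:
  assumes "k < n"
  shows "\<bar>layer_density p n g (Suc k) - layer_density p n g k\<bar>
           \<le> up_boundary p n g k / (real (n - k) * pmf (binomial_pmf n p) k)"
proof -
  let ?M = "pmf (binomial_pmf n p)"
  have pos: "?M k > 0" "?M (Suc k) > 0"
    using assms p by auto
  \<comment> \<open>\<open>p\<close> times the total weight of the edges between the two layers\<close>
  define w where "w = p * real (n - k) * ?M k"
  have w: "w > 0" "w = (1 - p) * real (Suc k) * ?M (Suc k)"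
    using assms p pos binomial_step[of k n] by (auto simp: w_def)
  have "layer_density p n g (Suc k) - layer_density p n g k =
    ((1 - p) * real (Suc k) * layer_mass p n g (Suc k) - p * real (n - k) * layer_mass p n g k) / w"
  proof -
    have "layer_density p n g (Suc k) = (1 - p) * real (Suc k) * layer_mass p n g (Suc k) / w"
      using w pos p by (simp add: layer_density_def del: of_nat_Suc)
    moreover have "layer_density p n g k = p * real (n - k) * layer_mass p n g k / w"
      using assms pos p by (simp add: layer_density_def w_def)
    ultimately show ?thesis by (simp add: diff_divide_distrib)
  qed
  then have "\<bar>layer_density p n g (Suc k) - layer_density p n g k\<bar> \<le> p * up_boundary p n g k / w"
    using layer_mass_step[of k n g] w(1) by (simp add: divide_right_mono abs_divide)
  also have "\<dots> = up_boundary p n g k / (real (n - k) * ?M k)"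
    using p by (simp add: w_def)
  finally show ?thesis .
qed

section \<open>Binomial weights of the central layers\<close>

lemma window_mass:
  assumes "n > 0"
  shows "measure_pmf.prob (binomial_pmf n p) (- window p n) \<le> 2 / 9"
proof -
  have "- window p n = {k. \<bar>real k - real n * p\<bar> \<ge> 2 * sqrt (real n)}"
    by (auto simp: window_def)
  also have "measure_pmf.prob (binomial_pmf n p) \<dots> \<le> 2 * exp (- 2 * (2 * sqrt (real n))\<^sup>2 / real n)"
    using p assms by (intro binomial_distribution.prob_abs_ge) (auto simp: binomial_distribution_def)
  also have "- 2 * (2 * sqrt (real n))\<^sup>2 / real n = - 8"
    using assms by (simp add: power_mult_distrib)
  also have "2 * exp (- 8 :: real) \<le> 2 / 9"
    using exp_ge_add_one_self[of 8] by (simp add: exp_minus field_simps)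
  finally show ?thesis by simp
qed

text \<open>
  The two quantities bounded here are the coefficients in \<open>binomial_step\<close>: in the window both are
  \<open>p (1 - p) n\<close> up to an error of order \<open>\<surd>n\<close>.
\<close>

lemma window_below:
  assumes "6 \<le> p * (1 - p) * sqrt (real n)" "k \<in> window p n"
  shows "k < n"
    "\<bar>p * real (n - k) - p * (1 - p) * real n\<bar> \<le> 2 * sqrt (real n)"
    "\<bar>(1 - p) * real (Suc k) - p * (1 - p) * real n\<bar> \<le> 3 * sqrt (real n)"
proof -
  define r where "r = sqrt (real n)"
  have r2: "r * r = real n" by (simp add: r_def)
  have "p * (1 - p) \<le> 1 * (1 - p)" "1 * (1 - p) \<le> 1 * 1"
    using p by (auto intro!: mult_right_mono)
  then have v: "p * (1 - p) \<le> 1 - p" "p * (1 - p) \<le> 1" by auto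
  have "0 \<le> r" by (simp add: r_def)
  have "p * (1 - p) * r \<le> 1 * r"
    using v \<open>0 \<le> r\<close> by (intro mult_right_mono) auto
  then have r6: "6 \<le> r" using assms(1) by (simp add: r_def)
  have "6 * r \<le> p * (1 - p) * r * r"
    using assms(1) r6 by (intro mult_right_mono) (auto simp: r_def)
  also have "\<dots> \<le> (1 - p) * (r * r)"
    using v \<open>0 \<le> r\<close> by (simp add: mult_right_mono mult.assoc[symmetric])
  finally have "6 * r \<le> real n - real n * p"
    by (simp add: r2 algebra_simps)
  moreover have d: "\<bar>real k - real n * p\<bar> < 2 * r"
    using assms(2) by (simp add: window_def r_def)
  ultimately have "real k < real n" using r6 by linarith
  then show kn: "k < n" by simp
  have "p * real (n - k) - p * (1 - p) * real n = - (p * (real k - real n * p))"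
    using kn by (simp add: of_nat_diff algebra_simps)
  moreover have "\<bar>p * (real k - real n * p)\<bar> \<le> 1 * (2 * r)"
    unfolding abs_mult using p d by (intro mult_mono) auto
  ultimately show "\<bar>p * real (n - k) - p * (1 - p) * real n\<bar> \<le> 2 * sqrt (real n)"
    by (simp add: r_def)
  have "(1 - p) * real (Suc k) - p * (1 - p) * real n = (1 - p) * (real k - real n * p + 1)"
    by (simp add: algebra_simps)
  moreover have "\<bar>(1 - p) * (real k - real n * p + 1)\<bar> \<le> 1 * (3 * r)"
    unfolding abs_mult using p d r6 by (intro mult_mono) auto
  ultimately show "\<bar>(1 - p) * real (Suc k) - p * (1 - p) * real n\<bar> \<le> 3 * sqrt (real n)"
    by (simp add: r_def)
qed

text \<open>
  With \<open>t = p (1 - p) \<surd>n\<close>, both coefficients in \<open>binomial_step\<close> lie between \<open>(t - 3) \<surd>n\<close> and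
  \<open>(t + 3) \<surd>n\<close>, and \<open>(t + 3) / (t - 3) \<le> 1 + 12 / t \<le> exp (12 / t)\<close> as soon as \<open>t \<ge> 6\<close>.
\<close>

lemma binomial_neighbour_ratio:
  assumes v: "6 \<le> p * (1 - p) * sqrt (real n)" and k: "k \<in> window p n"
  defines "q \<equiv> exp (12 / (p * (1 - p) * sqrt (real n)))"
  shows "pmf (binomial_pmf n p) (Suc k) \<le> q * pmf (binomial_pmf n p) k"
    and "pmf (binomial_pmf n p) k \<le> q * pmf (binomial_pmf n p) (Suc k)"
proof -
  define r t where "r = sqrt (real n)" and "t = p * (1 - p) * r"
  have r0: "0 \<le> r" by (simp add: r_def)
  have rn: "r * r = real n" by (simp add: r_def)
  have t6: "6 \<le> t" using v by (simp add: t_def r_def)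
  have r: "0 < r" using t6 r0 by (cases "r = 0") (auto simp: t_def)
  define \<alpha> \<beta> where "\<alpha> = p * real (n - k)" and "\<beta> = (1 - p) * real (Suc k)"
  have tr: "p * (1 - p) * real n = t * r"
    unfolding rn[symmetric] by (simp add: t_def)
  have \<alpha>: "(t - 3) * r \<le> \<alpha>" "\<alpha> \<le> (t + 3) * r" and \<beta>: "(t - 3) * r \<le> \<beta>" "\<beta> \<le> (t + 3) * r"
    using window_below(2,3)[OF v k] r
    unfolding tr \<alpha>_def[symmetric] \<beta>_def[symmetric] r_def[symmetric] abs_le_iff
    by (auto simp: algebra_simps)
  have "t + 3 \<le> (1 + 12 / t) * (t - 3)"
    using t6 by (simp add: field_simps)
  also have "\<dots> \<le> q * (t - 3)"
    using exp_ge_add_one_self[of "12 / t"] t6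
    by (intro mult_right_mono) (auto simp: q_def t_def r_def)
  finally have tq: "(t + 3) * r \<le> q * ((t - 3) * r)"
    using r by (metis mult.assoc mult_right_mono less_imp_le)
  have q: "q > 0" by (simp add: q_def)
  have pos: "0 < (t - 3) * r" using t6 r by simp
  have le: "\<alpha> \<le> q * \<beta>" "\<beta> \<le> q * \<alpha>"
    using \<alpha> \<beta> tq mult_left_mono[OF \<alpha>(1), of q] mult_left_mono[OF \<beta>(1), of q] q by linarith+
  let ?M = "pmf (binomial_pmf n p)"
  have eq: "\<beta> * ?M (Suc k) = \<alpha> * ?M k"
    using binomial_step[of k n] by (simp add: \<alpha>_def \<beta>_def)
  have "\<beta> * ?M (Suc k) \<le> \<beta> * (q * ?M k)"
    using eq mult_right_mono[OF le(1), of "?M k"] by (simp add: mult_ac)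
  then show "?M (Suc k) \<le> q * ?M k"
    using \<beta>(1) pos by (metis mult_le_cancel_left_pos less_le_trans)
  have "\<alpha> * ?M k \<le> \<alpha> * (q * ?M (Suc k))"
    using eq mult_right_mono[OF le(2), of "?M (Suc k)"] by (simp add: mult_ac)
  then show "?M k \<le> q * ?M (Suc k)"
    using \<alpha>(1) pos by (metis mult_le_cancel_left_pos less_le_trans)
qed

text \<open>
  Two indices in the window are at most \<open>4 \<surd>n\<close> steps apart, and each step costs a factor
  \<open>exp (12 / (p (1 - p) \<surd>n))\<close>: the \<open>\<surd>n\<close> cancels.
\<close>

lemma binomial_window_comparable:
  assumes v: "6 \<le> p * (1 - p) * sqrt (real n)" and kl: "k \<in> window p n" "l \<in> window p n"
  shows "pmf (binomial_pmf n p) k \<le> exp (48 / (p * (1 - p))) * pmf (binomial_pmf n p) l"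
proof -
  let ?M = "pmf (binomial_pmf n p)" and ?q = "exp (12 / (p * (1 - p) * sqrt (real n)))"
  have q_pow: "?q ^ (b - a) \<le> exp (48 / (p * (1 - p)))"
    if "a \<in> window p n" "b \<in> window p n" "a \<le> b" for a b
  proof -
    have "real (b - a) * (12 / (p * (1 - p) * sqrt (real n)))
        \<le> 4 * sqrt (real n) * (12 / (p * (1 - p) * sqrt (real n)))"
      using window_diff[OF that] v by (intro mult_right_mono) auto
    also have "\<dots> = 48 / (p * (1 - p))"
      using v by (cases "n = 0") auto
    finally show ?thesis
      by (simp add: exp_of_nat_mult[symmetric])
  qed
  have chain: "?M b \<le> ?q ^ (b - a) * ?M a \<and> ?M a \<le> ?q ^ (b - a) * ?M b"
    if "a \<in> window p n" "b \<in> window p n" "a \<le> b" for a b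
    using that binomial_neighbour_ratio[OF v] window_convex[OF that(1,2)]
    by (intro bounded_ratio_chain) auto
  have comp: "?M b \<le> exp (48 / (p * (1 - p))) * ?M a \<and> ?M a \<le> exp (48 / (p * (1 - p))) * ?M b"
    if "a \<in> window p n" "b \<in> window p n" "a \<le> b" for a b
    using chain[OF that] mult_right_mono[OF q_pow[OF that], of "?M a"]
      mult_right_mono[OF q_pow[OF that], of "?M b"] by force
  show ?thesis
    using comp[of k l] comp[of l k] kl by (cases "k \<le> l") auto
qed

text \<open>
  The weights in the window add up to at least \<open>7/9\<close>, there are at most \<open>5 \<surd>n\<close> of them, and none
  exceeds a constant multiple of the weight of \<open>k\<close>.
\<close>

lemma binomial_window_lower_bound:
  assumes v: "6 \<le> p * (1 - p) * sqrt (real n)" and k: "k \<in> window p n"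
  shows "exp (- 48 / (p * (1 - p))) / (9 * sqrt (real n)) \<le> pmf (binomial_pmf n p) k"
proof -
  let ?M = "pmf (binomial_pmf n p)" and ?W = "window p n" and ?E = "exp (48 / (p * (1 - p)))"
  have n: "n > 0" using v by (cases "n = 0") auto
  have r: "1 \<le> sqrt (real n)" using n by simp
  have "1 - 2 / 9 \<le> measure_pmf.prob (binomial_pmf n p) ?W"
    using window_mass[OF n] measure_pmf.prob_compl[of ?W "binomial_pmf n p"]
    by (simp add: Compl_eq_Diff_UNIV)
  also have "\<dots> = (\<Sum>l\<in>?W. ?M l)"
    by (simp add: measure_measure_pmf_finite)
  also have "\<dots> \<le> (\<Sum>l\<in>?W. ?E * ?M k)"
    using binomial_window_comparable[OF v _ k] by (intro sum_mono) auto
  also have "\<dots> = real (card ?W) * (?E * ?M k)"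
    by simp
  also have "\<dots> \<le> (5 * sqrt (real n)) * (?E * ?M k)"
    using order.trans[OF card_window_le[of p n], of "5 * sqrt (real n)"] r
    by (intro mult_right_mono) (linarith, simp)
  finally have "7 / 9 \<le> 5 * sqrt (real n) * (?E * ?M k)" by simp
  then have "1 \<le> ?M k * ?E * (9 * sqrt (real n))" by (simp add: mult_ac)
  then show ?thesis
    using r by (simp add: exp_minus field_simps)
qed

section \<open>Functions of small influence have flat layer densities\<close>

text \<open>
  The increments of the density are boundary masses divided by the mass of the edges going up from
  the layer. The latter is at least \<open>m\<close>, of order \<open>\<surd>n\<close>, throughout the window, and the former add
  up to at most a constant times the influence.
\<close>

lemma layer_density_oscillation_le:
  defines "v \<equiv> p * (1 - p)"
  assumes large: "6 \<le> v * sqrt (real n)" and kl: "k \<in> window p n" "l \<in> window p n"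
  shows "\<bar>layer_density p n g l - layer_density p n g k\<bar>
           \<le> 18 * total_influence p n g / (exp (- 48 / v) * v\<^sup>2 * sqrt (real n))"
proof -
  define r c where "r = sqrt (real n)" and "c = exp (- 48 / v)"
  \<comment> \<open>from \<open>n - j \<ge> v r\<^sup>2 / 2\<close> and the binomial weight \<open>c / (9 r)\<close>\<close>
  define m where "m = c * v * r / 18"
  have v: "v > 0" using p by (simp add: v_def)
  have vr: "6 \<le> v * r" using large by (simp add: r_def)
  have r: "r > 0" using vr v by (metis less_le_trans zero_less_mult_pos zero_less_numeral)
  have c: "c > 0" by (simp add: c_def)
  have m: "m > 0" using c v r by (simp add: m_def)
  have edge_mass: "m \<le> real (n - j) * pmf (binomial_pmf n p) j" if j: "j \<in> window p n" for j
  proof -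
    have "v * r * r / 2 \<le> (v * r - 2) * r"
      using vr mult_right_mono[of "v * r / 2" "v * r - 2" r] r by (simp add: algebra_simps)
    also have "\<dots> = v * real n - 2 * r"
      using r by (simp add: left_diff_distrib r_def)
    also have "\<dots> \<le> p * real (n - j)"
      using window_below(2)[OF _ j] large unfolding v_def r_def by auto
    also have "\<dots> \<le> real (n - j)"
      using p by (simp add: mult_left_le_one_le)
    finally have "v * r * r / 2 \<le> real (n - j)" .
    moreover have "c / (9 * r) \<le> pmf (binomial_pmf n p) j"
      using binomial_window_lower_bound[OF _ j] large by (simp add: v_def c_def r_def)
    ultimately have "(v * r * r / 2) * (c / (9 * r)) \<le> real (n - j) * pmf (binomial_pmf n p) j"
      using c r by (intro mult_mono) auto
    then show ?thesis
      using r by (simp add: m_def mult_ac)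
  qed
  have ordered: "\<bar>layer_density p n g b - layer_density p n g a\<bar> \<le> (\<Sum>j\<le>n. up_boundary p n g j) / m"
    if ab: "a \<in> window p n" "b \<in> window p n" "a \<le> b" for a b
  proof -
    have below: "j < n" if "j \<in> window p n" for j
      using window_below(1)[OF _ that] large by (simp add: v_def)
    have "\<bar>layer_density p n g b - layer_density p n g a\<bar> =
        \<bar>\<Sum>j=a..<b. layer_density p n g (Suc j) - layer_density p n g j\<bar>"
      using ab by (simp add: sum_Suc_diff')
    also have "\<dots> \<le> (\<Sum>j=a..<b. \<bar>layer_density p n g (Suc j) - layer_density p n g j\<bar>)"
      by (rule sum_abs)
    also have "\<dots> \<le> (\<Sum>j=a..<b. up_boundary p n g j / m)"
    proof (intro sum_mono)
      fix j assume "j \<in> {a..<b}"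
      then have j: "j \<in> window p n"
        using window_convex[OF ab(1,2), of j] by simp
      have "\<bar>layer_density p n g (Suc j) - layer_density p n g j\<bar>
          \<le> up_boundary p n g j / (real (n - j) * pmf (binomial_pmf n p) j)"
        by (rule layer_density_step[OF below[OF j]])
      also have "\<dots> \<le> up_boundary p n g j / m"
        using edge_mass[OF j] m
        by (intro divide_left_mono up_boundary_nonneg mult_pos_pos[OF less_le_trans])
      finally show "\<bar>layer_density p n g (Suc j) - layer_density p n g j\<bar> \<le> \<dots>" .
    qed
    also have "\<dots> \<le> (\<Sum>j\<le>n. up_boundary p n g j / m)"
      using below[OF ab(2)] m up_boundary_nonneg by (intro sum_mono2) auto
    finally show ?thesis by (simp add: sum_divide_distrib)
  qed
  have "\<bar>layer_density p n g l - layer_density p n g k\<bar> \<le> (\<Sum>j\<le>n. up_boundary p n g j) / m"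
    using ordered[of k l] ordered[of l k] kl by (cases "k \<le> l") (auto simp: abs_minus_commute)
  also have "\<dots> \<le> (total_influence p n g / v) / m"
    using total_influence_ge[of n g] v m
    by (intro divide_right_mono) (auto simp: v_def field_simps)
  also have "\<dots> = 18 * total_influence p n g / (c * v\<^sup>2 * r)"
    by (simp add: m_def power2_eq_square mult_ac)
  finally show ?thesis by (simp add: c_def r_def)
qed

section \<open>Disagreement with a balanced symmetric function\<close>

lemma prob_mu_by_layers:
  "measure_pmf.prob (mu p n) {x. \<phi> x} = (\<Sum>k\<le>n. layer_mass p n \<phi> k)"
  unfolding prob_mu sum_cube_by_layers layer_mass_def by simp

lemma window_mass_of_symmetric:
  assumes n: "n > 0" and large: "window p n \<subseteq> {..n}"
    and F: "\<And>x k. x \<in> layer n k \<Longrightarrow> f x = F k"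
  shows "measure_pmf.prob (mu p n) {x. f x} - 2 / 9
           \<le> (\<Sum>k\<in>window p n. pmf (binomial_pmf n p) k * of_bool (F k))"
proof -
  let ?M = "pmf (binomial_pmf n p)"
  have "layer_mass p n f k = ?M k * of_bool (F k)" for k
    unfolding layer_mass_True[symmetric] layer_mass_def sum_distrib_right
    by (intro sum.cong) (simp_all add: F)
  then have "measure_pmf.prob (mu p n) {x. f x} = (\<Sum>k\<le>n. ?M k * of_bool (F k))"
    by (simp add: prob_mu_by_layers)
  also have "\<dots> = (\<Sum>k\<in>{..n} - window p n. ?M k * of_bool (F k)) + (\<Sum>k\<in>window p n. ?M k * of_bool (F k))"
    using large by (intro sum.subset_diff) auto
  also have "(\<Sum>k\<in>{..n} - window p n. ?M k * of_bool (F k)) \<le> (\<Sum>k\<in>{..n} - window p n. ?M k)"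
    by (intro sum_mono) auto
  also have "\<dots> = measure_pmf.prob (binomial_pmf n p) ({..n} - window p n)"
    by (simp add: measure_measure_pmf_finite)
  also have "\<dots> \<le> measure_pmf.prob (binomial_pmf n p) (- window p n)"
    by (intro measure_pmf.finite_measure_mono) auto
  also have "\<dots> \<le> 2 / 9"
    by (rule window_mass[OF n])
  finally show ?thesis by simp
qed

lemma disagreement_on_layer:
  assumes F: "\<And>x. x \<in> layer n k \<Longrightarrow> f x = b" and k: "k \<le> n"
  shows "layer_mass p n (\<lambda>x. f x \<noteq> g x) k =
    pmf (binomial_pmf n p) k * (if b then 1 - layer_density p n g k else layer_density p n g k)"
proof -
  have pos: "pmf (binomial_pmf n p) k > 0"
    using k p by auto
  have "layer_mass p n (\<lambda>x. f x \<noteq> g x) k =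
      (if b then layer_mass p n (\<lambda>_. True) k - layer_mass p n g k else layer_mass p n g k)"
    unfolding layer_mass_def
    by (auto simp: F sum_subtractf[symmetric] simp del: sum_mult_of_bool_eq sum_of_bool_mult_eq
        intro!: sum.cong)
  then show ?thesis
    using pos by (simp add: layer_mass_True layer_density_def right_diff_distrib)
qed

text \<open>
  With \<open>\<gamma>\<close> the density on any one central layer, the disagreement is at least
  \<open>(1 - \<gamma>) P1 + \<gamma> P0 - \<eta>\<close>, where \<open>P1\<close> and \<open>P0\<close> are the masses of the central layers with \<open>f = 1\<close>
  and \<open>f = 0\<close>. Balancedness makes both masses at least \<open>1/9\<close>, and hence also their convex
  combination, whatever \<open>\<gamma>\<close> is.
\<close>

lemma disagreement_ge:
  assumes n: "n > 0" and large: "window p n \<subseteq> {..n}" and f: "symmetric_fun n f"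
    and balanced: "1 / 3 \<le> measure_pmf.prob (mu p n) {x. f x}" "measure_pmf.prob (mu p n) {x. f x} \<le> 2 / 3"
    and flat: "\<And>k l. k \<in> window p n \<Longrightarrow> l \<in> window p n \<Longrightarrow>
      \<bar>layer_density p n g l - layer_density p n g k\<bar> \<le> \<eta>"
  shows "1 / 9 - \<eta> \<le> measure_pmf.prob (mu p n) {x. f x \<noteq> g x}"
proof -
  let ?M = "pmf (binomial_pmf n p)" and ?W = "window p n"
  \<comment> \<open>the common value of \<open>f\<close> on layer \<open>k\<close>; layers above \<open>n\<close> are empty and their value is arbitrary\<close>
  define F where "F k = f (SOME x. x \<in> layer n k)" for k
  have F: "f x = F k" if "x \<in> layer n k" for x k
    unfolding F_def by (rule symmetric_fun_eq[OF f that]) (rule someI[of "\<lambda>x. x \<in> layer n k", OF that])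
  obtain k0 where k0: "k0 \<in> ?W"
    using window_nonempty[OF p(1) n] by blast
  define \<gamma> where "\<gamma> = layer_density p n g k0"
  have \<gamma>: "0 \<le> \<gamma>" "\<gamma> \<le> 1"
    using layer_density_bounds by (auto simp: \<gamma>_def)
  have \<eta>: "0 \<le> \<eta>" using flat[OF k0 k0] by simp
  define P1 P0 where "P1 = (\<Sum>k\<in>?W. ?M k * of_bool (F k))" and "P0 = (\<Sum>k\<in>?W. ?M k * of_bool (\<not> F k))"
  have "measure_pmf.prob (mu p n) {x. \<not> f x} = 1 - measure_pmf.prob (mu p n) {x. f x}"
    using measure_pmf.prob_compl[of "{x. f x}" "mu p n"] by (simp add: set_diff_eq)
  then have P: "1 / 9 \<le> P1" "1 / 9 \<le> P0"
    using window_mass_of_symmetric[OF n large, of f F] balanced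
      window_mass_of_symmetric[OF n large, of "\<lambda>x. \<not> f x" "\<lambda>k. \<not> F k"] F
    by (auto simp: P1_def P0_def)
  have "(\<Sum>k\<in>?W. ?M k) \<le> 1"
    using measure_pmf.prob_le_1[of "binomial_pmf n p" ?W] by (simp add: measure_measure_pmf_finite)
  then have "\<eta> * (\<Sum>k\<in>?W. ?M k) \<le> \<eta>"
    using \<eta> by (simp add: mult_left_le)
  moreover have "1 / 9 = (1 - \<gamma>) * (1 / 9) + \<gamma> * (1 / 9)"
    by (simp add: field_simps)
  moreover have "\<dots> \<le> (1 - \<gamma>) * P1 + \<gamma> * P0"
    using \<gamma> P by (intro add_mono mult_left_mono) auto
  ultimately have "1 / 9 - \<eta> \<le> (1 - \<gamma>) * P1 + \<gamma> * P0 - \<eta> * (\<Sum>k\<in>?W. ?M k)"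
    by linarith
  also have "\<dots> = (\<Sum>k\<in>?W. ?M k * ((if F k then 1 - \<gamma> else \<gamma>) - \<eta>))"
    unfolding P1_def P0_def sum_distrib_left sum.distrib[symmetric] sum_subtractf[symmetric]
    by (intro sum.cong) (auto simp: algebra_simps)
  also have "\<dots> \<le> (\<Sum>k\<in>?W. layer_mass p n (\<lambda>x. f x \<noteq> g x) k)"
  proof (intro sum_mono)
    fix k assume k: "k \<in> ?W"
    have "\<bar>layer_density p n g k - \<gamma>\<bar> \<le> \<eta>"
      using flat[OF k0 k] by (simp add: \<gamma>_def)
    then have "(if F k then 1 - \<gamma> else \<gamma>) - \<eta> \<le> (if F k then 1 - layer_density p n g k else layer_density p n g k)"
      by auto
    moreover have "layer_mass p n (\<lambda>x. f x \<noteq> g x) k =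
        ?M k * (if F k then 1 - layer_density p n g k else layer_density p n g k)"
      using k large by (intro disagreement_on_layer) (auto simp: F)
    ultimately show "?M k * ((if F k then 1 - \<gamma> else \<gamma>) - \<eta>) \<le> layer_mass p n (\<lambda>x. f x \<noteq> g x) k"
      by (metis mult_left_mono pmf_nonneg)
  qed
  also have "\<dots> \<le> (\<Sum>k\<le>n. layer_mass p n (\<lambda>x. f x \<noteq> g x) k)"
    using large layer_mass_nonneg by (intro sum_mono2) auto
  also have "\<dots> = measure_pmf.prob (mu p n) {x. f x \<noteq> g x}"
    by (rule prob_mu_by_layers[symmetric])
  finally show ?thesis .
qed

text \<open>
  One factor of \<open>324 = 18 * 18\<close> cancels the 18 in \<open>layer_density_oscillation_le\<close>, and the other makes
  the oscillation of the density at most \<open>1/18\<close>, half of the \<open>1/9\<close> available in \<open>disagreement_ge\<close>.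
\<close>

lemma disagreement_ge_of_small_influence:
  defines "v \<equiv> p * (1 - p)"
  assumes large: "6 \<le> v * sqrt (real n)" and f: "symmetric_fun n f"
    and balanced: "1 / 3 \<le> measure_pmf.prob (mu p n) {x. f x}" "measure_pmf.prob (mu p n) {x. f x} \<le> 2 / 3"
    and g: "total_influence p n g \<le> exp (- 48 / v) * v\<^sup>2 / 324 * sqrt (real n)"
  shows "1 / 18 \<le> measure_pmf.prob (mu p n) {x. f x \<noteq> g x}"
proof -
  have n: "n > 0" using large by (cases "n = 0") auto
  define B where "B = exp (- 48 / v) * v\<^sup>2 * sqrt (real n)"
  have "B > 0" using n p by (simp add: B_def v_def)
  then have "18 * total_influence p n g / B \<le> 1 / 18"
    using g by (simp add: B_def field_simps)
  then have "\<bar>layer_density p n g l - layer_density p n g k\<bar> \<le> 1 / 18"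
    if "k \<in> window p n" "l \<in> window p n" for k l
    using layer_density_oscillation_le[of n k l g] large that unfolding v_def B_def by linarith
  moreover have "window p n \<subseteq> {..n}"
    using window_below(1) large by (auto simp: v_def intro: less_imp_le)
  ultimately have "1 / 9 - 1 / 18 \<le> measure_pmf.prob (mu p n) {x. f x \<noteq> g x}"
    by (intro disagreement_ge n f balanced)
  then show ?thesis by simp
qed

end

lemma expectation_of_bool:
  "measure_pmf.expectation M (\<lambda>x. of_bool (\<phi> x)) = measure_pmf.prob M {x. \<phi> x}"
proof -
  have "(\<lambda>x. of_bool (\<phi> x) :: real) = indicator {x. \<phi> x}"
    by (auto simp: indicator_def)
  then show ?thesis by simp
qed

theorem proposition8p5:
  shows "\<exists>\<delta>::real. \<delta> > 0 \<and>
    (\<forall>p::real. 0 < p \<and> p < 1 \<longrightarrow>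
      (\<forall>h :: nat \<Rightarrow> real. (\<forall>n. h n \<ge> 0) \<and> h \<in> o(\<lambda>n. sqrt (p * (1 - p) * real n)) \<longrightarrow>
        (\<forall>\<^sub>F n in sequentially.
          \<forall>f :: (nat \<Rightarrow> bool) \<Rightarrow> bool.
            symmetric_fun n f \<and>
            (1/3 :: real) \<le> measure_pmf.expectation (mu p n) (\<lambda>x. of_bool (f x)) \<and>
            measure_pmf.expectation (mu p n) (\<lambda>x. of_bool (f x)) \<le> (2/3 :: real) \<longrightarrow>
            (\<forall>g :: (nat \<Rightarrow> bool) \<Rightarrow> bool.
              total_influence p n g \<le> h n \<longrightarrow>
              measure_pmf.prob (mu p n) {x. f x \<noteq> g x} > \<delta>))))"
\<comment> \<open>any constant below the \<open>1/18\<close> of \<open>disagreement_ge_of_small_influence\<close>, as the claim is strict\<close>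
proof (intro exI[of _ "1 / 20"] conjI allI impI)
  fix p :: real and h :: "nat \<Rightarrow> real"
  assume "0 < p \<and> p < 1"
    and h: "(\<forall>n. h n \<ge> 0) \<and> h \<in> o(\<lambda>n. sqrt (p * (1 - p) * real n))"
  then have p: "0 < p" "p < 1" by auto
  define v where "v = p * (1 - p)"
  define \<epsilon> where "\<epsilon> = exp (- 48 / v) * v\<^sup>2 / 324"
  have v: "0 < v" "v \<le> 1"
    using p mult_le_one[of p "1 - p"] by (auto simp: v_def)
  have \<epsilon>: "\<epsilon> > 0" using v by (simp add: \<epsilon>_def)
  have h_le: "\<forall>\<^sub>F n in sequentially. h n \<le> \<epsilon> * sqrt (real n)"
  proof -
    have "\<forall>\<^sub>F n in sequentially. norm (h n) \<le> \<epsilon> * norm (sqrt (p * (1 - p) * real n))"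
      using h \<epsilon> by (intro landau_o.smallD) auto
    then show ?thesis
    proof eventually_elim
      case (elim n)
      have "\<epsilon> * sqrt (v * real n) \<le> \<epsilon> * sqrt (real n)"
        using v \<epsilon> by (intro mult_left_mono real_sqrt_le_mono) (auto simp: mult_left_le_one_le)
      moreover have "h n \<le> \<epsilon> * sqrt (v * real n)"
        using elim v by (simp add: v_def[symmetric])
      ultimately show ?case by linarith
    qed
  qed
  have "\<forall>\<^sub>F n in sequentially. 6 \<le> v * sqrt (real n)"
    using v by real_asymp
  with h_le show "\<forall>\<^sub>F n in sequentially. \<forall>f. symmetric_fun n f \<and>
      (1/3 :: real) \<le> measure_pmf.expectation (mu p n) (\<lambda>x. of_bool (f x)) \<and>
      measure_pmf.expectation (mu p n) (\<lambda>x. of_bool (f x)) \<le> (2/3 :: real) \<longrightarrow>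
      (\<forall>g. total_influence p n g \<le> h n \<longrightarrow> measure_pmf.prob (mu p n) {x. f x \<noteq> g x} > 1 / 20)"
  proof eventually_elim
    case (elim n)
    have "1 / 20 < measure_pmf.prob (mu p n) {x. f x \<noteq> g x}"
      if "symmetric_fun n f" "1 / 3 \<le> measure_pmf.prob (mu p n) {x. f x}"
        "measure_pmf.prob (mu p n) {x. f x} \<le> 2 / 3" "total_influence p n g \<le> h n" for f g
      using disagreement_ge_of_small_influence[OF p _ that(1-3), of g] elim that(4)
      by (simp add: v_def \<epsilon>_def)
    then show ?case
      unfolding expectation_of_bool by blast
  qed
qed simp

end
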